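(* (a) For all integers $d\ge1$ and $n\ge1$ there exists a $d$-regular bipartite graph (multiple edges allowed) on $2n$ vertices with an edge $e$ such that \[p(e)=\frac{1}{(d-1)^n+1}.\] (b) For all integers $d\ge1$ and $n\ge1$ there exists a $d$-regular bipartite simple graph on $2dn$ vertices with an edge $e$ such that $p(e)=\frac{1}{(d-1)^n+1}$.
   Context: For a finite graph admitting a perfect matching and an edge $e$ of it, $p(e)$ is the probability that $e$ is contained in a uniformly random perfect matching of the graph (with parallel edges regarded as distinct). *)

theory Defs
  imports "HOL-Probability.Probability_Mass_Function"
begin

text \<open>Undirected multigraphs: edges are objects of their own, each with a set of end vertices, so
  that parallel edges are distinct edges with the same ends.\<close>

record ('v, 'e) multigraph =
  verts :: "'v set"
  edges :: "'e set"
  ends :: "'e \<Rightarrow> 'v set"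

text \<open>Loops are excluded; all graphs considered are bipartite, so this is no restriction.\<close>

definition finite_multigraph :: "('v, 'e) multigraph \<Rightarrow> bool" where
  "finite_multigraph G \<longleftrightarrow> finite (verts G) \<and> finite (edges G) \<and>
     (\<forall>e\<in>edges G. ends G e \<subseteq> verts G \<and> card (ends G e) = 2)"

definition simple_graph :: "('v, 'e) multigraph \<Rightarrow> bool" where
  "simple_graph G \<longleftrightarrow> finite_multigraph G \<and> inj_on (ends G) (edges G)"

definition degree :: "('v, 'e) multigraph \<Rightarrow> 'v \<Rightarrow> nat" where
  "degree G v = card {e \<in> edges G. v \<in> ends G e}"

definition regular :: "nat \<Rightarrow> ('v, 'e) multigraph \<Rightarrow> bool" where
  "regular d G \<longleftrightarrow> (\<forall>v\<in>verts G. degree G v = d)"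

definition bipartite :: "('v, 'e) multigraph \<Rightarrow> bool" where
  "bipartite G \<longleftrightarrow> (\<exists>A B. A \<union> B = verts G \<and> A \<inter> B = {} \<and>
     (\<forall>e\<in>edges G. \<exists>a\<in>A. \<exists>b\<in>B. ends G e = {a, b}))"

definition perfect_matching :: "('v, 'e) multigraph \<Rightarrow> 'e set \<Rightarrow> bool" where
  "perfect_matching G M \<longleftrightarrow> M \<subseteq> edges G \<and> (\<forall>v\<in>verts G. \<exists>!e. e \<in> M \<and> v \<in> ends G e)"

text \<open>Meaningful only if the set of perfect matchings is finite and nonempty, since
  \<^const>\<open>pmf_of_set\<close> is unspecified otherwise.\<close>

definition edge_prob :: "('v, 'e) multigraph \<Rightarrow> 'e \<Rightarrow> real" where
  "edge_prob G e = measure_pmf.prob (pmf_of_set {M. perfect_matching G M}) {M. e \<in> M}"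

end

theory Submission
  imports Defs "HOL-Combinatorics.Permutations"
begin

text \<open>
  Let \<open>H\<close> be a \<open>d\<close>-regular bipartite graph with an edge \<open>e\<^sub>0 = ab\<close> lying in a fraction \<open>1/d\<close> of
  its perfect matchings. Take \<open>n\<close> copies of \<open>H\<close> and replace the copies of \<open>e\<^sub>0\<close> by links joining \<open>b\<close>
  in copy \<open>i\<close> to \<open>a\<close> in copy \<open>i + 1\<close> (mod \<open>n\<close>). Since both sides of a copy have the same size, a
  perfect matching uses the link entering a copy iff it uses the link leaving it. Hence the perfect
  matchings of the new graph are the \<open>n\<close>-tuples of perfect matchings of \<open>H\<close> that either all contain
  \<open>e\<^sub>0\<close> or all avoid it, and a link has probability \<open>m\<^sup>n / (m\<^sup>n + ((d - 1) m)\<^sup>n)\<close>, where \<open>m\<close> matchings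
  of \<open>H\<close> contain \<open>e\<^sub>0\<close>. Two vertices joined by \<open>d\<close> parallel edges give (a), and \<open>K\<^bsub>d,d\<^esub>\<close> gives (b).
\<close>

section \<open>Bipartite multigraphs given by their end maps\<close>

text \<open>Turns the unique-edge condition of \<open>perfect_matching\<close> into bijectivity of
  an end map.\<close>

lemma bij_betw_iff_unique_preimage:
  assumes "f ` K \<subseteq> X"
  shows "bij_betw f K X \<longleftrightarrow> (\<forall>x\<in>X. \<exists>!k. k \<in> K \<and> x = f k)"
proof
  assume "bij_betw f K X"
  then show "\<forall>x\<in>X. \<exists>!k. k \<in> K \<and> x = f k"
    by (auto simp: bij_betw_def dest: inj_onD)
next
  assume unique: "\<forall>x\<in>X. \<exists>!k. k \<in> K \<and> x = f k"
  have "inj_on f K"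
  proof (rule inj_onI)
    fix k l assume "k \<in> K" "l \<in> K" "f k = f l"
    then show "k = l" using unique assms by blast
  qed
  moreover have "X \<subseteq> f ` K" using unique by blast
  ultimately show "bij_betw f K X" using assms by (auto simp: bij_betw_def)
qed

text \<open>Two end maps replace the end sets, so that matchings can be handled through bijections.
  Countability lets every instance be coded into a multigraph over \<open>nat\<close>.\<close>

locale bip_data =
  fixes A :: "'a::countable set" and B :: "'b::countable set" and E :: "'e::countable set"
    and \<alpha> :: "'e \<Rightarrow> 'a" and \<beta> :: "'e \<Rightarrow> 'b"
  assumes finite_A: "finite A" and finite_B: "finite B" and finite_E: "finite E"
    and \<alpha>_in: "\<And>e. e \<in> E \<Longrightarrow> \<alpha> e \<in> A" and \<beta>_in: "\<And>e. e \<in> E \<Longrightarrow> \<beta> e \<in> B"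
begin

text \<open>The sum type keeps the sides disjoint even when they are given by the same set.\<close>

definition graph :: "(nat, nat) multigraph" where
  "graph = \<lparr>verts = to_nat ` (A <+> B), edges = to_nat ` E,
     ends = (\<lambda>k. {to_nat (Inl (\<alpha> (from_nat k)) :: 'a + 'b), to_nat (Inr (\<beta> (from_nat k)) :: 'a + 'b)})\<rparr>"

text \<open>Perfect matchings before the coding by \<open>to_nat\<close>: a side is covered exactly
  once iff its end map is bijective on the matching.\<close>

definition matchings :: "'e set set" where
  "matchings = {M. M \<subseteq> E \<and> bij_betw \<alpha> M A \<and> bij_betw \<beta> M B}"

lemma finite_multigraph_graph: "finite_multigraph graph"
  using finite_A finite_B finite_E \<alpha>_in \<beta>_in
  by (auto simp: finite_multigraph_def graph_def)

text \<open>The tags \<open>Inl\<close> and \<open>Inr\<close> let the unordered pair of ends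
  determine the ordered one.\<close>

lemma simple_graph_graph:
  assumes "inj_on (\<lambda>e. (\<alpha> e, \<beta> e)) E"
  shows "simple_graph graph"
  using assms finite_multigraph_graph
  by (auto simp: simple_graph_def inj_on_def graph_def doubleton_eq_iff)

lemma bipartite_graph: "bipartite graph"
  unfolding bipartite_def
proof (intro exI conjI ballI)
  let ?A = "(\<lambda>a. to_nat (Inl a :: 'a + 'b)) ` A" and ?B = "(\<lambda>b. to_nat (Inr b :: 'a + 'b)) ` B"
  show "?A \<union> ?B = verts graph" "?A \<inter> ?B = {}"
    by (auto simp: graph_def Plus_def)
  fix k assume "k \<in> edges graph"
  then have "\<alpha> (from_nat k) \<in> A" "\<beta> (from_nat k) \<in> B"
    using \<alpha>_in \<beta>_in by (auto simp: graph_def)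
  then have ab: "to_nat (Inl (\<alpha> (from_nat k)) :: 'a + 'b) \<in> ?A" "to_nat (Inr (\<beta> (from_nat k)) :: 'a + 'b) \<in> ?B"
    by auto
  show "\<exists>a\<in>?A. \<exists>b\<in>?B. ends graph k = {a, b}"
    by (rule bexI[OF bexI[OF _ ab(2)] ab(1)]) (simp add: graph_def)
qed

lemma card_verts_graph: "card (verts graph) = card A + card B"
  by (simp add: graph_def card_image card_Plus finite_A finite_B)

lemma regular_graph:
  assumes "\<And>a. a \<in> A \<Longrightarrow> card {e \<in> E. \<alpha> e = a} = d"
    and "\<And>b. b \<in> B \<Longrightarrow> card {e \<in> E. \<beta> e = b} = d"
  shows "regular d graph"
proof -
  have "{k \<in> edges graph. to_nat (Inl a :: 'a + 'b) \<in> ends graph k} = to_nat ` {e \<in> E. \<alpha> e = a}" for a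
    by (auto simp: graph_def)
  moreover have "{k \<in> edges graph. to_nat (Inr b :: 'a + 'b) \<in> ends graph k} = to_nat ` {e \<in> E. \<beta> e = b}" for b
    by (auto simp: graph_def)
  moreover have "verts graph = to_nat ` (A <+> B)"
    by (simp add: graph_def)
  ultimately show ?thesis
    using assms by (auto simp: regular_def degree_def card_image)
qed

lemma perfect_matching_graph_iff:
  assumes "M \<subseteq> E"
  shows "perfect_matching graph (to_nat ` M) \<longleftrightarrow> M \<in> matchings"
proof -
  let ?K = "to_nat ` M"
  have to_nat: "bij_betw to_nat M ?K"
    by (simp add: bij_betw_def)
  have "perfect_matching graph ?K \<longleftrightarrow>
      (\<forall>a\<in>A. \<exists>!k. k \<in> ?K \<and> a = (\<alpha> \<circ> from_nat) k) \<and>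
      (\<forall>b\<in>B. \<exists>!k. k \<in> ?K \<and> b = (\<beta> \<circ> from_nat) k)"
    using assms by (auto simp: perfect_matching_def graph_def Plus_def ball_Un)
  also have "\<dots> \<longleftrightarrow> bij_betw (\<alpha> \<circ> from_nat) ?K A \<and> bij_betw (\<beta> \<circ> from_nat) ?K B"
    using assms \<alpha>_in \<beta>_in by (subst (1 2) bij_betw_iff_unique_preimage) auto
  also have "\<dots> \<longleftrightarrow> M \<in> matchings"
    using assms by (simp add: bij_betw_comp_iff[OF to_nat] comp_def matchings_def)
  finally show ?thesis .
qed

lemma perfect_matchings_graph: "{M. perfect_matching graph M} = (`) to_nat ` matchings"
proof (intro equalityI subsetI)
  fix N assume N: "N \<in> {M. perfect_matching graph M}"
  then have "N \<subseteq> to_nat ` E" by (simp add: perfect_matching_def graph_def)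
  then obtain M where "M \<subseteq> E" "N = to_nat ` M" by (auto simp: subset_image_iff)
  with N show "N \<in> (`) to_nat ` matchings"
    by (auto simp: perfect_matching_graph_iff)
next
  fix N assume "N \<in> (`) to_nat ` matchings"
  then obtain M where "M \<in> matchings" "N = to_nat ` M" by blast
  moreover from this have "M \<subseteq> E" by (simp add: matchings_def)
  ultimately show "N \<in> {M. perfect_matching graph M}"
    by (simp add: perfect_matching_graph_iff)
qed

lemma finite_matchings: "finite matchings"
  by (rule finite_subset[of _ "Pow E"]) (auto simp: matchings_def finite_E)

text \<open>Coding by \<open>to_nat\<close> is injective on edge sets, so counts are preserved;
  finiteness and nonemptiness make \<open>pmf_of_set\<close> the uniform distribution.\<close>

lemma edge_prob_graph:
  assumes "matchings \<noteq> {}"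
  shows "edge_prob graph (to_nat e) =
    real (card {M \<in> matchings. e \<in> M}) / real (card matchings)"
proof -
  have inj: "inj_on ((`) (to_nat :: 'e \<Rightarrow> nat)) X" for X
    by (auto intro!: inj_onI simp: inj_image_eq_iff)
  have "(`) to_nat ` matchings \<inter> {N. to_nat e \<in> N} = (`) to_nat ` {M \<in> matchings. e \<in> M}"
    by auto
  then show ?thesis
    using assms finite_matchings
    by (simp add: edge_prob_def perfect_matchings_graph measure_pmf_of_set card_image[OF inj])
qed

end


section \<open>Cyclic chains of copies\<close>

text \<open>Together with \<open>Suc_mod_surj\<close>: each copy in the cycle has exactly one
  predecessor.\<close>

lemma Suc_mod_inj:
  assumes "Suc i mod n = Suc j mod n" "i < n" "j < n"
  shows "i = j"
  using assms by (auto simp: mod_Suc split: if_splits)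

lemma Suc_mod_surj:
  assumes "j < n"
  obtains i where "i < n" "Suc i mod n = j"
proof (cases j)
  case 0
  then show ?thesis using assms that[of "n - 1"] by simp
next
  case (Suc k)
  then show ?thesis using assms that[of k] by simp
qed

locale cyclic_chain = bip_data A B E \<alpha> \<beta>
  for A :: "'a::countable set" and B :: "'b::countable set" and E :: "'e::countable set"
    and \<alpha> :: "'e \<Rightarrow> 'a" and \<beta> :: "'e \<Rightarrow> 'b" +
  fixes e0 :: 'e and n :: nat
  assumes card_sides: "card A = card B" and e0_in: "e0 \<in> E" and n_pos: "n > 0"
begin

text \<open>The pair \<open>(i, e0)\<close> codes the link leaving copy \<open>i\<close>. Only its
  \<open>\<alpha>\<close>-end moves to the next copy, so the \<open>\<beta>\<close>-side splits copy
  by copy. For \<open>n = 1\<close> the link is \<open>e0\<close> again.\<close>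

definition \<alpha>c :: "nat \<times> 'e \<Rightarrow> nat \<times> 'a" where
  "\<alpha>c = (\<lambda>(i, f). (if f = e0 then Suc i mod n else i, \<alpha> f))"

definition \<beta>c :: "nat \<times> 'e \<Rightarrow> nat \<times> 'b" where
  "\<beta>c = (\<lambda>(i, f). (i, \<beta> f))"

sublocale chain: bip_data "{..<n} \<times> A" "{..<n} \<times> B" "{..<n} \<times> E" \<alpha>c \<beta>c
  using n_pos
  by unfold_locales (auto simp: finite_A finite_B finite_E \<alpha>c_def \<beta>c_def \<alpha>_in \<beta>_in)

text \<open>The \<open>\<beta>\<close>-end still shows which copy an edge comes from, so links
  create no parallel edges.\<close>

lemma inj_chain:
  assumes "inj_on (\<lambda>e. (\<alpha> e, \<beta> e)) E"
  shows "inj_on (\<lambda>e. (\<alpha>c e, \<beta>c e)) ({..<n} \<times> E)"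
  using assms by (auto simp: inj_on_def \<alpha>c_def \<beta>c_def)

lemma regular_chain:
  assumes dA: "\<And>a. a \<in> A \<Longrightarrow> card {e \<in> E. \<alpha> e = a} = d"
    and dB: "\<And>b. b \<in> B \<Longrightarrow> card {e \<in> E. \<beta> e = b} = d"
  shows "regular d chain.graph"
proof (rule chain.regular_graph)
  fix x assume "x \<in> {..<n} \<times> A"
  then obtain j a where x: "x = (j, a)" "j < n" "a \<in> A" by auto
  obtain i where i: "i < n" "Suc i mod n = j"
    using Suc_mod_surj[OF \<open>j < n\<close>] .
  \<comment> \<open>\<open>?h\<close> enumerates the edges at \<open>x\<close>: if \<open>e0\<close>
    ends at \<open>a\<close>, its place is taken by the link from the predecessor \<open>i\<close>;
    all other edges come from copy \<open>j\<close> itself.\<close>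
  let ?h = "\<lambda>f. (if f = e0 then i else j, f)"
  have pred: "Suc k mod n = j \<longleftrightarrow> k = i" if "k < n" for k
    using that i Suc_mod_inj by blast
  have "\<alpha>c (k, f) = x \<longleftrightarrow> \<alpha> f = a \<and> k = (if f = e0 then i else j)" if "k < n" for k f
    using pred[OF that] x(1) by (cases "f = e0") (auto simp: \<alpha>c_def)
  then have "{e \<in> {..<n} \<times> E. \<alpha>c e = x} = ?h ` {e \<in> E. \<alpha> e = a}"
    using x(2) i(1) by auto
  moreover have "inj_on ?h X" for X by (auto intro: inj_onI)
  ultimately show "card {e \<in> {..<n} \<times> E. \<alpha>c e = x} = d"
    using dA[OF x(3)] by (simp add: card_image)
next
  fix y assume "y \<in> {..<n} \<times> B"
  then obtain j b where y: "y = (j, b)" "j < n" "b \<in> B" by auto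
  have "{e \<in> {..<n} \<times> E. \<beta>c e = y} = {j} \<times> {e \<in> E. \<beta> e = b}"
    using y by (auto simp: \<beta>c_def)
  then show "card {e \<in> {..<n} \<times> E. \<beta>c e = y} = d"
    using dB[OF y(3)] by (simp add: card_cartesian_product)
qed

text \<open>Gluing. The \<open>\<beta>\<close>-ends stay in their copies, so only the
  \<open>\<alpha>\<close>-side needs the agreement on \<open>e0\<close>.\<close>

lemma Sigma_matching:
  assumes F: "\<And>i. i < n \<Longrightarrow> F i \<in> matchings"
    and eq: "\<And>i j. i < n \<Longrightarrow> j < n \<Longrightarrow> e0 \<in> F i \<longleftrightarrow> e0 \<in> F j"
  shows "Sigma {..<n} F \<in> chain.matchings"
proof -
  have FE: "F i \<subseteq> E" and Fa: "bij_betw \<alpha> (F i) A" and Fb: "bij_betw \<beta> (F i) B" if "i < n" for i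
    using F[OF that] by (auto simp: matchings_def)
  have sub: "Sigma {..<n} F \<subseteq> {..<n} \<times> E"
    using FE by auto
  have fin: "finite (F i)" if "i < n" for i
    using FE[OF that] finite_E finite_subset by blast
  have "inj_on \<beta>c (Sigma {..<n} F)"
    using Fb by (auto simp: inj_on_def \<beta>c_def bij_betw_def)
  moreover have "\<beta>c ` Sigma {..<n} F = {..<n} \<times> B"
    using Fb by (force simp: \<beta>c_def bij_betw_def image_iff)
  moreover have inj: "inj_on \<alpha>c (Sigma {..<n} F)"
  proof (rule inj_onI, clarsimp)
    fix i f j g
    assume *: "i < n" "f \<in> F i" "j < n" "g \<in> F j" "\<alpha>c (i, f) = \<alpha>c (j, g)"
    then have "\<alpha> f = \<alpha> g" by (auto simp: \<alpha>c_def)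
    have same: "u = v" if "u \<in> F k" "v \<in> F k" "\<alpha> u = \<alpha> v" "k < n" for u v k
      using Fa[OF that(4)] that(1-3) by (auto simp: bij_betw_def inj_on_def)
    have "f = g"
    \<comment> \<open>If one edge is a link, both slices contain \<open>e0\<close> by agreement, and
      injectivity of \<open>\<alpha>\<close> within each slice forces \<open>f\<close> and
      \<open>g\<close> to be \<open>e0\<close>.\<close>
    proof (cases "f = e0 \<or> g = e0")
      case True
      then have "e0 \<in> F i" "e0 \<in> F j"
        using *(1-4) eq[of i j] by blast+
      then show ?thesis
        using True same[of f i e0] same[of g j e0] *(1-4) \<open>\<alpha> f = \<alpha> g\<close> by metis
    next
      case False
      then have "i = j" using *(5) by (simp add: \<alpha>c_def)
      then show ?thesis using same *(1-4) \<open>\<alpha> f = \<alpha> g\<close> by blast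
    qed
    with * show "i = j \<and> f = g"
      using Suc_mod_inj[of i n j] by (simp add: \<alpha>c_def split: if_splits)
  qed
  moreover have "\<alpha>c ` Sigma {..<n} F = {..<n} \<times> A"
  \<comment> \<open>Surjectivity by counting: each of the \<open>n\<close> slices has
    \<open>card A\<close> edges.\<close>
  proof (rule card_subset_eq)
    show "\<alpha>c ` Sigma {..<n} F \<subseteq> {..<n} \<times> A"
      using sub chain.\<alpha>_in by blast
    show "card (\<alpha>c ` Sigma {..<n} F) = card ({..<n} \<times> A)"
      using fin Fa[THEN bij_betw_same_card] by (simp add: card_image[OF inj] card_cartesian_product)
  qed (simp add: finite_A)
  ultimately show ?thesis
    using sub by (simp add: chain.matchings_def bij_betw_def)
qed

text \<open>Cutting, the converse of \<open>Sigma_matching\<close>. The \<open>\<beta>\<close>-side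
  fixes the size of each slice, and counting \<open>\<alpha>\<close>-ends then ties the use of
  \<open>e0\<close> in consecutive copies together.\<close>

lemma matching_slices:
  assumes "M \<in> chain.matchings"
  defines "F \<equiv> \<lambda>i. {f. (i, f) \<in> M}"
  shows "i < n \<Longrightarrow> F i \<in> matchings"
    and "i < n \<Longrightarrow> e0 \<in> F i \<longleftrightarrow> e0 \<in> F 0"
proof -
  have ME: "M \<subseteq> {..<n} \<times> E" and Ma: "bij_betw \<alpha>c M ({..<n} \<times> A)" and Mb: "bij_betw \<beta>c M ({..<n} \<times> B)"
    using assms(1) by (auto simp: chain.matchings_def)
  have FE: "F i \<subseteq> E" for i
    using ME by (auto simp: F_def)
  have fin: "finite (F i)" for i
    using FE finite_E finite_subset by blast
  have Fb: "bij_betw \<beta> (F i) B" if "i < n" for i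
    unfolding bij_betw_def
  proof
    show "inj_on \<beta> (F i)"
      using Mb by (auto simp: F_def inj_on_def bij_betw_def \<beta>c_def)
    show "\<beta> ` F i = B"
    proof (intro equalityI subsetI)
      fix b assume "b \<in> B"
      with that have "(i, b) \<in> \<beta>c ` M" using Mb by (simp add: bij_betw_def)
      then show "b \<in> \<beta> ` F i" by (auto simp: F_def \<beta>c_def)
    qed (use FE \<beta>_in in blast)
  qed
  then have cardF: "card (F i) = card A" if "i < n" for i
    using that card_sides bij_betw_same_card by metis
  \<comment> \<open>The edges of \<open>M\<close> with \<open>\<alpha>\<close>-end in copy
    \<open>?j\<close> number \<open>card A\<close>. They are \<open>F ?j\<close> without its
    outgoing link, plus the link from copy \<open>i\<close> if used. As \<open>F ?j\<close> also has
    \<open>card A\<close> elements, both links are used or neither.\<close>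
  have step: "e0 \<in> F (Suc i mod n) \<longleftrightarrow> e0 \<in> F i" if "i < n" for i
  proof -
    let ?j = "Suc i mod n"
    have j: "?j < n" using n_pos by simp
    let ?N = "{x \<in> M. fst (\<alpha>c x) = ?j}"
    have N: "?N = {?j} \<times> (F ?j - {e0}) \<union> (if e0 \<in> F i then {(i, e0)} else {})"
    proof -
      have "Suc k mod n = ?j \<longleftrightarrow> k = i" if "k < n" for k
        using that \<open>i < n\<close> Suc_mod_inj by blast
      then have "fst (\<alpha>c (k, f)) = ?j \<longleftrightarrow> k = (if f = e0 then i else ?j)" if "k < n" for k f
        using that by (cases "f = e0") (auto simp: \<alpha>c_def)
      moreover have "k < n" if "(k, f) \<in> M" for k f
        using that ME by auto
      ultimately show ?thesis
        by (auto simp: F_def split: if_splits)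
    qed
    have img: "\<alpha>c ` ?N = {?j} \<times> A"
    proof (intro equalityI subsetI)
      fix y assume y: "y \<in> {?j} \<times> A"
      then have "y \<in> \<alpha>c ` M" using Ma j by (auto simp: bij_betw_def)
      then obtain z where "z \<in> M" "y = \<alpha>c z" by blast
      moreover from this have "fst (\<alpha>c z) = ?j" using y by auto
      ultimately show "y \<in> \<alpha>c ` ?N" by blast
    next
      fix y assume "y \<in> \<alpha>c ` ?N"
      moreover have "\<alpha>c ` M \<subseteq> {..<n} \<times> A" using Ma by (simp add: bij_betw_def)
      ultimately show "y \<in> {?j} \<times> A" by force
    qed
    have "inj_on \<alpha>c ?N"
      using Ma by (auto simp: bij_betw_def inj_on_def)
    then have "card (\<alpha>c ` ?N) = card ?N"
      by (rule card_image)
    then have "card ?N = card A"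
      unfolding img by (simp add: card_cartesian_product_singleton)
    moreover have "card ?N = card (F ?j - {e0}) + (if e0 \<in> F i then 1 else 0)"
      unfolding N using fin[of ?j]
      by (cases "e0 \<in> F i") (simp_all add: card_cartesian_product_singleton)
    moreover have "card (F ?j) = card (F ?j - {e0}) + (if e0 \<in> F ?j then 1 else 0)"
      using fin[of ?j] card_Suc_Diff1[of "F ?j" e0] by simp
    ultimately have "(if e0 \<in> F i then 1 else 0 :: nat) = (if e0 \<in> F ?j then 1 else 0)"
      using cardF[OF j] by linarith
    then show ?thesis
      by (cases "e0 \<in> F i") (simp_all split: if_splits)
  qed
  show "e0 \<in> F i \<longleftrightarrow> e0 \<in> F 0" if "i < n" for i
    using that
  proof (induction i)
    case (Suc i)
    then show ?case using step[of i] by simp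
  qed simp
  show "F i \<in> matchings" if i: "i < n" for i
  proof -
    obtain k where k: "k < n" "Suc k mod n = i"
      using Suc_mod_surj[OF i] .
    \<comment> \<open>If the outgoing link is used, so is the incoming one from \<open>k\<close>, by
      \<open>step\<close>. It already covers \<open>\<alpha> e0\<close> in copy \<open>i\<close>,
      where \<open>g\<close> would be a second edge.\<close>
    have key: False if "e0 \<in> F i" "g \<in> F i" "g \<noteq> e0" "\<alpha> g = \<alpha> e0" for g
    proof -
      have "(k, e0) \<in> M" "(i, g) \<in> M"
        using step[OF k(1)] k(2) that by (auto simp: F_def)
      moreover have "\<alpha>c (k, e0) = \<alpha>c (i, g)"
        using that k by (simp add: \<alpha>c_def)
      ultimately have "(k, e0) = (i, g)"
        using Ma inj_onD[of \<alpha>c M "(k, e0)" "(i, g)"] by (simp only: bij_betw_def)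
      with that show False by simp
    qed
    have "inj_on \<alpha> (F i)"
    proof (rule inj_onI)
      fix f g assume fg: "f \<in> F i" "g \<in> F i" "\<alpha> f = \<alpha> g"
      show "f = g"
      proof (cases "f = e0 \<or> g = e0")
        case True
        then show ?thesis using key fg by metis
      next
        case False
        then have "\<alpha>c (i, f) = \<alpha>c (i, g)" using fg by (simp add: \<alpha>c_def)
        then show ?thesis
          using Ma fg unfolding bij_betw_def inj_on_def F_def by blast
      qed
    qed
    moreover have "\<alpha> ` F i = A"
      using card_subset_eq[of A "\<alpha> ` F i"] FE \<alpha>_in finite_A cardF[OF i] calculation
      by (metis card_image image_subset_iff subsetD)
    ultimately show ?thesis
      using FE Fb[OF i] by (simp add: matchings_def bij_betw_def)
  qed
qed

abbreviation "with_e0 \<equiv> {M \<in> matchings. e0 \<in> M}"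
abbreviation "without_e0 \<equiv> {M \<in> matchings. e0 \<notin> M}"

text \<open>Combines cutting and gluing. Extensional functions make each tuple determined by its
  entries below \<open>n\<close>, so \<open>Sigma\<close> is injective on them and they can be
  counted.\<close>

lemma chain_matchings:
  "chain.matchings =
     Sigma {..<n} ` (({..<n} \<rightarrow>\<^sub>E with_e0) \<union> ({..<n} \<rightarrow>\<^sub>E without_e0))"
proof (intro equalityI subsetI)
  fix M assume M: "M \<in> chain.matchings"
  let ?F = "restrict (\<lambda>i. {f. (i, f) \<in> M}) {..<n}"
  have "M = Sigma {..<n} ?F"
    using M by (auto simp: chain.matchings_def)
  moreover have "?F \<in> ({..<n} \<rightarrow>\<^sub>E with_e0) \<union> ({..<n} \<rightarrow>\<^sub>E without_e0)"
    using matching_slices[OF M] by (cases "(0, e0) \<in> M") (auto simp: PiE_iff)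
  ultimately show "M \<in> Sigma {..<n} ` (({..<n} \<rightarrow>\<^sub>E with_e0) \<union> ({..<n} \<rightarrow>\<^sub>E without_e0))"
    by (rule image_eqI)
next
  fix M assume "M \<in> Sigma {..<n} ` (({..<n} \<rightarrow>\<^sub>E with_e0) \<union> ({..<n} \<rightarrow>\<^sub>E without_e0))"
  then obtain F where M: "M = Sigma {..<n} F"
    and F: "F \<in> ({..<n} \<rightarrow>\<^sub>E with_e0) \<union> ({..<n} \<rightarrow>\<^sub>E without_e0)"
    by blast
  show "M \<in> chain.matchings"
    unfolding M by (rule Sigma_matching) (use F in \<open>auto simp: PiE_iff\<close>)
qed

lemma inj_Sigma: "inj_on (Sigma {..<n}) ({..<n} \<rightarrow>\<^sub>E X)"
proof (rule inj_onI)
  fix F G assume FG: "F \<in> {..<n} \<rightarrow>\<^sub>E X" "G \<in> {..<n} \<rightarrow>\<^sub>E X" "Sigma {..<n} F = Sigma {..<n} G"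
  show "F = G"
  proof (rule PiE_ext[OF FG(1,2)])
    fix i assume "i \<in> {..<n}"
    then show "F i = G i" using FG(3) by (auto simp: set_eq_iff)
  qed
qed

lemma chain_edge_prob:
  assumes total: "card matchings = d * card with_e0" and pos: "card with_e0 > 0"
  shows "chain.matchings \<noteq> {}"
    and "edge_prob chain.graph (to_nat (0 :: nat, e0)) = 1 / ((real d - 1) ^ n + 1)"
proof -
  let ?P0 = "{..<n} \<rightarrow>\<^sub>E with_e0" and ?P1 = "{..<n} \<rightarrow>\<^sub>E without_e0"
  let ?m = "card with_e0"
  have fin: "finite with_e0" "finite without_e0"
    using finite_matchings by auto
  \<comment> \<open>Since \<open>n > 0\<close>, component \<open>0\<close> exists and decides
    between the two kinds of tuples.\<close>
  have disj: "Sigma {..<n} ` ?P0 \<inter> Sigma {..<n} ` ?P1 = {}"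
    using n_pos by (fastforce simp: PiE_iff set_eq_iff)
  have card0: "card (Sigma {..<n} ` ?P0) = ?m ^ n"
    by (simp add: card_image[OF inj_Sigma] card_PiE)
  have card1: "card (Sigma {..<n} ` ?P1) = card without_e0 ^ n"
    by (simp add: card_image[OF inj_Sigma] card_PiE)
  have "matchings = with_e0 \<union> without_e0" by auto
  then have "card matchings = ?m + card without_e0"
    using fin card_Un_disjoint[of with_e0 without_e0] by auto
  \<comment> \<open>Stated in the reals, where \<open>real d - 1\<close> is not truncated.\<close>
  then have without: "real (card without_e0) = (real d - 1) * real ?m"
    using total by (simp add: algebra_simps flip: of_nat_mult of_nat_add)
  \<comment> \<open>Whether the link \<open>(0, e0)\<close> is used is read off component
    \<open>0\<close>, and this selects exactly the tuples in which every component contains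
    \<open>e0\<close>.\<close>
  have "{M \<in> chain.matchings. (0, e0) \<in> M} = Sigma {..<n} ` ?P0"
    unfolding chain_matchings using n_pos by (auto simp: PiE_iff)
  then have with_card: "card {M \<in> chain.matchings. (0, e0) \<in> M} = ?m ^ n"
    using card0 by simp
  then show ne: "chain.matchings \<noteq> {}"
    using pos by (auto simp: card_gt_0_iff)
  have "card chain.matchings = ?m ^ n + card without_e0 ^ n"
    unfolding chain_matchings image_Un using fin disj
    by (subst card_Un_disjoint) (auto simp: card0 card1 intro!: finite_PiE)
  then have "real (card chain.matchings) = real ?m ^ n * ((real d - 1) ^ n + 1)"
    by (simp only: of_nat_add of_nat_power without power_mult_distrib) (simp add: distrib_left)
  then show "edge_prob chain.graph (to_nat (0 :: nat, e0)) = 1 / ((real d - 1) ^ n + 1)"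
    using pos by (simp add: chain.edge_prob_graph[OF ne] with_card)
qed

text \<open>Leaves only the degrees and the fraction \<open>1/d\<close> to be checked for a concrete
  base graph.\<close>

lemma chain_graph_properties:
  assumes "\<And>a. a \<in> A \<Longrightarrow> card {e \<in> E. \<alpha> e = a} = d"
    and "\<And>b. b \<in> B \<Longrightarrow> card {e \<in> E. \<beta> e = b} = d"
    and "card matchings = d * card with_e0" and "card with_e0 > 0"
  shows "bipartite chain.graph \<and> regular d chain.graph \<and>
    card (verts chain.graph) = 2 * card A * n \<and> (\<exists>M. perfect_matching chain.graph M) \<and>
    to_nat (0 :: nat, e0) \<in> edges chain.graph \<and>
    edge_prob chain.graph (to_nat (0 :: nat, e0)) = 1 / ((real d - 1) ^ n + 1)"
proof (intro conjI)
  show "card (verts chain.graph) = 2 * card A * n"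
    by (simp add: chain.card_verts_graph card_cartesian_product flip: card_sides)
  show "\<exists>M. perfect_matching chain.graph M"
    using chain_edge_prob(1)[OF assms(3,4)] chain.perfect_matchings_graph by blast
  show "to_nat (0 :: nat, e0) \<in> edges chain.graph"
    using n_pos e0_in by (simp add: chain.graph_def)
  show "regular d chain.graph"
    using assms(1,2) by (rule regular_chain)
  show "bipartite chain.graph"
    by (rule chain.bipartite_graph)
  show "edge_prob chain.graph (to_nat (0 :: nat, e0)) = 1 / ((real d - 1) ^ n + 1)"
    using assms(3,4) by (rule chain_edge_prob(2))
qed

end


section \<open>The two base graphs\<close>

text \<open>A perfect matching of \<open>d\<close> parallel edges is a single edge, so edge
  \<open>0\<close> lies in exactly one of \<open>d\<close>.\<close>

lemma parallel_edges_chain: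
  assumes "d \<ge> 1" "n \<ge> 1"
  shows "\<exists>(G :: (nat, nat) multigraph) e. finite_multigraph G \<and> bipartite G \<and> regular d G \<and>
    card (verts G) = 2 * n \<and> (\<exists>M. perfect_matching G M) \<and>
    e \<in> edges G \<and> edge_prob G e = 1 / ((real d - 1) ^ n + 1)"
proof -
  interpret cyclic_chain "UNIV :: unit set" "UNIV :: unit set" "{..<d}" "\<lambda>_. ()" "\<lambda>_. ()" 0 n
    using assms by unfold_locales auto
  have "M \<in> matchings \<longleftrightarrow> M \<in> (\<lambda>k. {k}) ` {..<d}" for M
  proof -
    have "bij_betw (\<lambda>_. ()) M UNIV \<longleftrightarrow> (\<exists>k. M = {k})"
      by (auto simp: bij_betw_iff_unique_preimage Ex1_def)
    then show ?thesis
      unfolding matchings_def by auto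
  qed
  then have m: "matchings = (\<lambda>k. {k}) ` {..<d}"
    by blast
  have "card matchings = d"
    unfolding m by (subst card_image) (auto simp: inj_on_def)
  moreover have w: "with_e0 = {{0}}"
    unfolding m using assms by auto
  ultimately have "card matchings = d * card with_e0" "card with_e0 > 0"
    unfolding w by simp_all
  then show ?thesis
    using chain_graph_properties[of d] chain.finite_multigraph_graph
    by (intro exI[of _ chain.graph] exI[of _ "to_nat (0 :: nat, 0 :: nat)"]) auto
qed

text \<open>A permutation of \<open>S\<close> fixing \<open>a\<close> is the same as a permutation
  of \<open>S - {a}\<close>.\<close>

lemma card_permutes_fixing:
  assumes "finite S" "a \<in> S"
  shows "card {p. p permutes S \<and> p a = a} = fact (card S - 1)"
proof -
  have "p permutes S \<and> p a = a \<longleftrightarrow> p permutes (S - {a})" for p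
    using permutes_superset[of p S "S - {a}"] permutes_subset[of p "S - {a}" S]
      permutes_not_in[of p "S - {a}" a] assms(2) by blast
  then show ?thesis
    using assms by (simp add: card_permutations)
qed

text \<open>Perfect matchings of the complete bipartite graph are the graphs of permutations of
  \<open>{..<d}\<close>. Those containing \<open>(0, 0)\<close> fix \<open>0\<close>, which gives
  \<open>fact (d - 1)\<close> out of \<open>fact d\<close>.\<close>

lemma complete_bipartite_chain:
  assumes "d \<ge> 1" "n \<ge> 1"
  shows "\<exists>(G :: (nat, nat) multigraph) e. simple_graph G \<and> bipartite G \<and> regular d G \<and>
    card (verts G) = 2 * d * n \<and> (\<exists>M. perfect_matching G M) \<and>
    e \<in> edges G \<and> edge_prob G e = 1 / ((real d - 1) ^ n + 1)"
proof -
  interpret cyclic_chain "{..<d}" "{..<d}" "{..<d} \<times> {..<d}" fst snd "(0, 0)" n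
    using assms by unfold_locales auto
  let ?g = "\<lambda>p. (\<lambda>i. (i, p i)) ` {..<d}"
  have m: "matchings = ?g ` {p. p permutes {..<d}}"
  proof (intro equalityI subsetI)
    fix M assume "M \<in> matchings"
    then have ME: "M \<subseteq> {..<d} \<times> {..<d}" and Ma: "bij_betw fst M {..<d}" and Mb: "bij_betw snd M {..<d}"
      by (auto simp: matchings_def)
    \<comment> \<open>\<open>p\<close> sends \<open>i\<close> to its partner in \<open>M\<close>;
      the identity beyond \<open>d\<close> is what \<open>permutes\<close> demands.\<close>
    define p where "p i = (if i < d then snd (the_inv_into M fst i) else i)" for i
    have "bij_betw (snd \<circ> the_inv_into M fst) {..<d} {..<d}"
      using bij_betw_trans[OF bij_betw_the_inv_into[OF Ma] Mb] .
    then have "bij_betw p {..<d} {..<d}"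
      by (rule bij_betw_cong[THEN iffD1, rotated]) (simp add: p_def)
    then have "p permutes {..<d}"
      by (rule bij_imp_permutes) (simp add: p_def)
    moreover have "M = ?g p"
    proof -
      have "(\<lambda>i. (i, p i)) ` fst ` M = (\<lambda>x. x) ` M"
        unfolding image_image
      proof (rule image_cong[OF refl])
        fix x assume "x \<in> M"
        moreover from this have "fst x < d" using ME by auto
        ultimately show "(fst x, p (fst x)) = x"
          using Ma by (simp add: p_def the_inv_into_f_f bij_betw_def)
      qed
      then show ?thesis using Ma by (simp add: bij_betw_def)
    qed
    ultimately show "M \<in> ?g ` {p. p permutes {..<d}}" by blast
  next
    fix M assume "M \<in> ?g ` {p. p permutes {..<d}}"
    then obtain p where p: "p permutes {..<d}" and M: "M = ?g p" by blast
    have "bij_betw p {..<d} {..<d}" using p by (rule permutes_imp_bij)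
    then show "M \<in> matchings"
      unfolding M by (auto simp: matchings_def bij_betw_def inj_on_def image_image)
  qed
  have inj: "inj_on ?g {p. p permutes {..<d}}"
  proof (rule inj_onI, clarify)
    fix p q assume p: "p permutes {..<d}" and q: "q permutes {..<d}" and eq: "?g p = ?g q"
    show "p = q"
    proof
      fix i
      show "p i = q i"
        \<comment> \<open>Equal graphs give agreement below \<open>d\<close>; elsewhere both
          permutations are the identity.\<close>
        using eq p q by (cases "i < d") (auto simp: permutes_not_in)
    qed
  qed
  have "card matchings = fact d"
    by (simp add: m card_image[OF inj] card_permutations)
  moreover have "with_e0 = ?g ` {p. p permutes {..<d} \<and> p 0 = 0}"
    unfolding m using assms by force
  then have "card with_e0 = card {p. p permutes {..<d} \<and> p 0 = 0}"
    using inj by (simp add: card_image inj_on_def)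
  then have "card with_e0 = fact (d - 1)"
    using assms by (simp add: card_permutes_fixing)
  ultimately have counts: "card matchings = d * card with_e0" "card with_e0 > 0"
    using assms by (simp_all add: fact_reduce)
  have "{e \<in> {..<d} \<times> {..<d}. fst e = a} = {a} \<times> {..<d}"
    "{e \<in> {..<d} \<times> {..<d}. snd e = a} = {..<d} \<times> {a}" if "a < d" for a
    using that by auto
  then have "card {e \<in> {..<d} \<times> {..<d}. fst e = a} = d"
    "card {e \<in> {..<d} \<times> {..<d}. snd e = a} = d" if "a < d" for a
    using that by (simp_all add: card_cartesian_product)
  moreover have "simple_graph chain.graph"
    by (intro chain.simple_graph_graph inj_chain) (auto simp: inj_on_def)
  ultimately show ?thesis
    using chain_graph_properties[of d] counts
    by (intro exI[of _ chain.graph] exI[of _ "to_nat (0 :: nat, (0 :: nat, 0 :: nat))"]) auto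
qed

theorem theorem5p2:
  fixes d n :: nat
  assumes "d \<ge> 1" and "n \<ge> 1"
  shows "(\<exists>(G :: (nat, nat) multigraph) e.
            finite_multigraph G \<and> bipartite G \<and> regular d G \<and> card (verts G) = 2 * n \<and>
            (\<exists>M. perfect_matching G M) \<and>
            e \<in> edges G \<and> edge_prob G e = 1 / ((real d - 1) ^ n + 1)) \<and>
         (\<exists>(G :: (nat, nat) multigraph) e.
            simple_graph G \<and> bipartite G \<and> regular d G \<and> card (verts G) = 2 * d * n \<and>
            (\<exists>M. perfect_matching G M) \<and>
            e \<in> edges G \<and> edge_prob G e = 1 / ((real d - 1) ^ n + 1))"
  using assms parallel_edges_chain complete_bipartite_chain by blast

end
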